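(* Let $A$ be a finite matrix over $\mathbb F_2$, and let $G(A)$ be its support graph. Then $$\tau(A)=\max_\prec\lambda_\prec(A)=\nu_{\rm ur}(G(A))\le\operatorname{rank}A,$$ where the maximum is over all total orders $\prec$ of the row set of $A$, and $\nu_{\rm ur}$ is the maximum uniquely restricted matching number.
   Context: The columns of $A$ are labelled (distinct labelled columns may have equal vectors). For a column $c$, $\operatorname{Supp}(c)$ is the set of rows in which $c$ has entry one. The support graph $G(A)$ is the bipartite graph whose vertex classes are the rows and the labelled columns of $A$, with an edge for each entry equal to one. For a total order $\prec$ on rows and a nonzero column $c$, $\mathrm{LM}_\prec(c)$ is the largest row in $\operatorname{Supp}(c)$, and $\lambda_\prec(A)=\#\{\mathrm{LM}_\prec(c):c\ne0\}$. Choose a set $C_0$ of nonzero labelled columns and distinct rows $p(c)\in\operatorname{Supp}(c)$ for $c\in C_0$. The chosen pivots are acyclic if the directed graph on rows with arrows $r\to p(c)$ for all $c\in C_0$ and $r\in\operatorname{Supp}(c)\setminus\{p(c)\}$ has no directed cycle. $\tau(A)$ is the largest possible $|C_0|$ over all choices of acyclic pivots. A matching in a bipartite graph is uniquely restricted if it is the unique perfect matching of the subgraph induced by its matched vertices; $\nu_{\rm ur}(G)$ is the largest size of a uniquely restricted matching of $G$. Maxima over empty families are zero. *)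

theory Defs
  imports
    "HOL-Library.Z2"
    "HOL-Library.Disjoint_Sets"
    "Jordan_Normal_Form.DL_Rank"
begin

text \<open>
  A matrix over the two-element field is a \<^typ>\<open>bit mat\<close>. Rows are the indices below
  \<^term>\<open>dim_row A\<close>; the labels of the columns are the indices below \<^term>\<open>dim_col A\<close>, so that
  columns with equal entries remain distinct.
\<close>

definition supp :: "bit mat \<Rightarrow> nat \<Rightarrow> nat set" where
  "supp A c = {r. r < dim_row A \<and> A $$ (r, c) = 1}"

definition nonzero_cols :: "bit mat \<Rightarrow> nat set" where
  "nonzero_cols A = {c. c < dim_col A \<and> col A c \<noteq> 0\<^sub>v (dim_row A)}"

text \<open>
  A total order on the rows is given by its reflexive version, a relation \<open>R\<close> with
  \<open>linear_order_on {..<dim_row A} R\<close>, where \<open>(r, s) \<in> R\<close> means that \<open>r\<close> is at most \<open>s\<close>.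
\<close>

definition leading_row :: "nat rel \<Rightarrow> bit mat \<Rightarrow> nat \<Rightarrow> nat" where
  "leading_row R A c = (THE r. r \<in> supp A c \<and> (\<forall>s \<in> supp A c. (s, r) \<in> R))"

definition num_leading_rows :: "nat rel \<Rightarrow> bit mat \<Rightarrow> nat" where
  "num_leading_rows R A = card (leading_row R A ` nonzero_cols A)"

definition row_orders :: "bit mat \<Rightarrow> nat rel set" where
  "row_orders A = {R. linear_order_on {..<dim_row A} R}"

definition pivot_arrows :: "bit mat \<Rightarrow> nat set \<Rightarrow> (nat \<Rightarrow> nat) \<Rightarrow> nat rel" where
  "pivot_arrows A C p = {(r, p c) | r c. c \<in> C \<and> r \<in> supp A c - {p c}}"

definition acyclic_pivots :: "bit mat \<Rightarrow> nat set \<Rightarrow> (nat \<Rightarrow> nat) \<Rightarrow> bool" where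
  "acyclic_pivots A C p \<longleftrightarrow>
     C \<subseteq> nonzero_cols A \<and> (\<forall>c \<in> C. p c \<in> supp A c) \<and> inj_on p C \<and>
     acyclic (pivot_arrows A C p)"

text \<open>The family below always contains the empty choice, so the maximum is over a nonempty finite set.\<close>

definition tau :: "bit mat \<Rightarrow> nat" where
  "tau A = Max {card C | C. \<exists>p. acyclic_pivots A C p}"

text \<open>
  A finite simple graph is a pair of a vertex set and a set of edges, each edge being the set of
  its two endpoints.
\<close>

type_synonym 'v sgraph = "'v set \<times> 'v set set"

definition matching :: "'v sgraph \<Rightarrow> 'v set set \<Rightarrow> bool" where
  "matching G M \<longleftrightarrow> M \<subseteq> snd G \<and> disjoint M"

definition perfect_matching :: "'v sgraph \<Rightarrow> 'v set set \<Rightarrow> bool" where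
  "perfect_matching G M \<longleftrightarrow> matching G M \<and> \<Union>M = fst G"

definition induced_sgraph :: "'v sgraph \<Rightarrow> 'v set \<Rightarrow> 'v sgraph" where
  "induced_sgraph G W = (fst G \<inter> W, {e \<in> snd G. e \<subseteq> W})"

definition uniquely_restricted :: "'v sgraph \<Rightarrow> 'v set set \<Rightarrow> bool" where
  "uniquely_restricted G M \<longleftrightarrow>
     matching G M \<and>
     perfect_matching (induced_sgraph G (\<Union>M)) M \<and>
     (\<forall>M'. perfect_matching (induced_sgraph G (\<Union>M)) M' \<longrightarrow> M' = M)"

text \<open>The empty matching is uniquely restricted, so this is a maximum over a nonempty
  family for every graph; it is meant for finite graphs.\<close>

definition nu_ur :: "'v sgraph \<Rightarrow> nat" where
  "nu_ur G = Max {card M | M. uniquely_restricted G M}"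

text \<open>Rows become \<^const>\<open>Inl\<close> vertices and column labels \<^const>\<open>Inr\<close> vertices.\<close>

definition support_graph :: "bit mat \<Rightarrow> (nat + nat) sgraph" where
  "support_graph A =
     (Inl ` {..<dim_row A} \<union> Inr ` {..<dim_col A},
      {{Inl r, Inr c} | r c. r < dim_row A \<and> c < dim_col A \<and> A $$ (r, c) = 1})"

end

theory Submission imports Defs begin

text \<open>
  All three quantities count the same objects, seen through numberings of the rows. Acyclicity of a
  choice of pivots means that the rows can be numbered injectively so that every arrow goes up, that
  is, so that each pivot has the largest number in the support of its column
  (\<open>acyclic_pivots_iff_numbering\<close>). The order given by such a numbering has
  the chosen pivots among its leading rows; conversely, the leading rows of any order, each
  represented by one column, form acyclic pivots, because every arrow goes up in that order
  (\<open>tau_eq_Max_num_leading_rows\<close>).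

  A matching of the support graph is a set of columns together with an injective choice \<open>p\<close> of a
  row in each support, and it is uniquely restricted if \<open>p\<close> is the only bijection from these columns
  to these rows that stays in the supports. This happens exactly for acyclic pivots
  (\<open>uniquely_restricted_iff_acyclic_pivots\<close>). If the pivots are the largest entries of
  their columns for some numbering, another bijection would lower some of the numbers
  and raise none, although it has the same sum of numbers over the columns. If there is a directed
  cycle, moving every pivot on the cycle to its predecessor gives another bijection.

  For the rank, order the chosen columns by the numbers of their pivots: the square submatrix of
  these columns and their pivot rows becomes triangular with nonzero diagonal, so the columns are
  linearly independent (\<open>triangular_columns_card_le_rank\<close>).
\<close>

section \<open>Acyclic relations and numberings\<close>

text \<open>
  The number of strict predecessors grows along every arrow; an arbitrary enumeration of the vertices
  breaks the ties, which makes the numbering injective.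
\<close>

lemma acyclic_imp_increasing_numbering:
  fixes E :: "'a rel"
  assumes "finite V" and EV: "E \<subseteq> V \<times> V" and ac: "acyclic E"
  obtains w :: "'a \<Rightarrow> nat" where "inj_on w V" and "\<And>r s. (r, s) \<in> E \<Longrightarrow> w r < w s"
proof -
  obtain g :: "'a \<Rightarrow> nat" and n where g: "g ` V = {i. i < n}" "inj_on g V"
    using finite_imp_inj_to_nat_seg[OF \<open>finite V\<close>] by metis
  define h where "h s = card {r. (r, s) \<in> E\<^sup>+}" for s
  define w where "w s = h s * n + g s" for s
  have g_less: "g s < n" if "s \<in> V" for s
    using g(1) that by auto
  have "inj_on w V"
  proof (rule inj_onI)
    fix r s assume "r \<in> V" "s \<in> V" "w r = w s"
    moreover have "w q mod n = g q" if "q \<in> V" for q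
      using g_less[OF that] by (simp add: w_def)
    ultimately have "g r = g s" by metis
    then show "r = s" using g(2) \<open>r \<in> V\<close> \<open>s \<in> V\<close> by (auto dest: inj_onD)
  qed
  moreover have "w r < w s" if rs: "(r, s) \<in> E" for r s
  proof -
    have "E\<^sup>+ \<subseteq> V \<times> V" using EV by (rule trancl_subset_Sigma)
    then have fin: "finite {q. (q, s) \<in> E\<^sup>+}"
      by (intro finite_subset[OF _ \<open>finite V\<close>]) auto
    have "{q. (q, r) \<in> E\<^sup>+} \<subset> {q. (q, s) \<in> E\<^sup>+}"
    proof
      show "{q. (q, r) \<in> E\<^sup>+} \<subseteq> {q. (q, s) \<in> E\<^sup>+}"
        using rs by (auto intro: trancl_into_trancl)
      have "(r, r) \<notin> E\<^sup>+" using ac by (simp add: acyclic_def)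
      then show "{q. (q, r) \<in> E\<^sup>+} \<noteq> {q. (q, s) \<in> E\<^sup>+}"
        using rs by blast
    qed
    then have "h r < h s" unfolding h_def using fin by (rule psubset_card_mono[rotated])
    then have "Suc (h r) * n \<le> h s * n" by (intro mult_right_mono) auto
    moreover have "g r < n" using g_less rs EV by auto
    ultimately show ?thesis by (simp add: w_def)
  qed
  ultimately show thesis using that by blast
qed

lemma increasing_numbering_imp_acyclic:
  fixes w :: "'a \<Rightarrow> nat"
  assumes "\<And>r s. (r, s) \<in> E \<Longrightarrow> w r < w s"
  shows "acyclic E"
proof -
  have "w r < w s" if "(r, s) \<in> E\<^sup>+" for r s
    using that by (induction) (auto dest: assms)
  then show ?thesis by (auto simp: acyclic_def)
qed

text \<open>
  This is how a directed cycle is used below: as a set of vertices permuted by a map that sends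
  each of them to a predecessor. It avoids the bookkeeping of a cyclic path without repetitions.
\<close>

lemma not_acyclic_imp_predecessor_permutation:
  assumes "finite V" and EV: "E \<subseteq> V \<times> V" and "\<not> acyclic E"
  obtains S g where "S \<subseteq> V" "S \<noteq> {}" "bij_betw g S S" "\<forall>s\<in>S. (g s, s) \<in> E"
proof -
  have "finite E" using EV \<open>finite V\<close> by (meson finite_SigmaI finite_subset)
  then have "\<not> wf E" using \<open>\<not> acyclic E\<close> wf_acyclic by blast
  then obtain Q q0 where "q0 \<in> Q" and "\<not> (\<exists>s\<in>Q. \<forall>r. (r, s) \<in> E \<longrightarrow> r \<notin> Q)"
    by (auto simp only: wf_eq_minimal)
  then have Q: "q0 \<in> Q" "\<And>s. s \<in> Q \<Longrightarrow> \<exists>r. (r, s) \<in> E \<and> r \<in> Q"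
    by simp_all
  obtain g where g: "\<And>s. s \<in> Q \<Longrightarrow> (g s, s) \<in> E \<and> g s \<in> Q"
    using Q(2) by metis
  define P where "P S \<longleftrightarrow> S \<noteq> {} \<and> S \<subseteq> Q \<and> g ` S \<subseteq> S" for S
  have "Q \<subseteq> V" using g EV by blast
  then have "finite Q" using \<open>finite V\<close> by (rule finite_subset)
  have "P Q" using Q(1) g by (auto simp: P_def)
  \<comment> \<open>The image of a closed set is closed, so the map is onto a smallest nonempty closed set.\<close>
  then obtain S where "P S" and min: "\<And>T. P T \<Longrightarrow> card S \<le> card T"
    using ex_has_least_nat[of P Q card] by metis
  then have S: "S \<noteq> {}" "S \<subseteq> Q" "g ` S \<subseteq> S" by (simp_all add: P_def)
  have fS: "finite S" using S(2) \<open>finite Q\<close> by (rule finite_subset)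
  have "P (g ` S)" using S by (auto simp: P_def)
  then have "card S \<le> card (g ` S)" by (rule min)
  then have "g ` S = S" using S(3) fS by (simp add: card_seteq)
  then have "bij_betw g S S"
    using fS by (simp add: bij_betw_def finite_surj_inj)
  moreover have "S \<subseteq> V" using S(2) \<open>Q \<subseteq> V\<close> by (rule subset_trans)
  moreover have "\<forall>s\<in>S. (g s, s) \<in> E" using g S(2) by blast
  ultimately show thesis using that S(1) by metis
qed

section \<open>Acyclic pivots and leading rows\<close>

lemma finite_supp: "finite (supp A c)"
  by (simp add: supp_def)

lemma nonzero_cols_iff: "c \<in> nonzero_cols A \<longleftrightarrow> c < dim_col A \<and> supp A c \<noteq> {}"
  by (auto simp: nonzero_cols_def supp_def vec_eq_iff)

lemma acyclic_pivots_iff_numbering: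
  "acyclic_pivots A C p \<longleftrightarrow>
     C \<subseteq> nonzero_cols A \<and> (\<forall>c\<in>C. p c \<in> supp A c) \<and> inj_on p C \<and>
     (\<exists>w :: nat \<Rightarrow> nat. inj_on w {..<dim_row A} \<and>
        (\<forall>c\<in>C. \<forall>r\<in>supp A c - {p c}. w r < w (p c)))"
  (is "_ \<longleftrightarrow> ?base \<and> ?inc \<and> ?inj \<and> ?num")
proof -
  have "acyclic (pivot_arrows A C p) \<longleftrightarrow> ?num" if ?inc
  proof
    assume "acyclic (pivot_arrows A C p)"
    moreover have "pivot_arrows A C p \<subseteq> {..<dim_row A} \<times> {..<dim_row A}"
      using \<open>?inc\<close> by (auto simp: pivot_arrows_def supp_def)
    ultimately obtain w :: "nat \<Rightarrow> nat" where "inj_on w {..<dim_row A}"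
      and "\<And>r s. (r, s) \<in> pivot_arrows A C p \<Longrightarrow> w r < w s"
      using acyclic_imp_increasing_numbering[of "{..<dim_row A}"] by blast
    then show ?num by (intro exI[of _ w]) (auto simp: pivot_arrows_def)
  next
    assume ?num
    then obtain w :: "nat \<Rightarrow> nat" where "\<forall>c\<in>C. \<forall>r\<in>supp A c - {p c}. w r < w (p c)"
      by blast
    then show "acyclic (pivot_arrows A C p)"
      by (intro increasing_numbering_imp_acyclic[of _ w]) (auto simp: pivot_arrows_def)
  qed
  then show ?thesis unfolding acyclic_pivots_def by blast
qed

lemma leading_row_eqI:
  assumes "R \<in> row_orders A" "r \<in> supp A c" "\<And>s. s \<in> supp A c \<Longrightarrow> (s, r) \<in> R"
  shows "leading_row R A c = r"
  unfolding leading_row_def using assms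
  by (intro the_equality) (auto simp: row_orders_def order_on_defs dest: antisymD)

lemma row_order_of_numbering:
  fixes w :: "nat \<Rightarrow> nat"
  assumes "inj_on w {..<dim_row A}"
  shows "{(r, s). r < dim_row A \<and> s < dim_row A \<and> w r \<le> w s} \<in> row_orders A"
  using assms
  by (auto simp: row_orders_def order_on_defs refl_on_def trans_def antisym_def total_on_def
      dest: inj_onD)

lemma row_order_imp_numbering:
  assumes "R \<in> row_orders A"
  obtains w :: "nat \<Rightarrow> nat" where "inj_on w {..<dim_row A}"
    "\<And>r s. (r, s) \<in> R \<Longrightarrow> r \<noteq> s \<Longrightarrow> w r < w s"
proof -
  have R: "linear_order_on {..<dim_row A} R" using assms by (simp add: row_orders_def)
  then have "acyclic (R - Id)" by (rule linear_order_on_acyclic)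
  moreover have "R - Id \<subseteq> {..<dim_row A} \<times> {..<dim_row A}"
    using R by (auto simp: order_on_defs)
  ultimately obtain w :: "nat \<Rightarrow> nat" where "inj_on w {..<dim_row A}"
      "\<And>r s. (r, s) \<in> R - Id \<Longrightarrow> w r < w s"
    using acyclic_imp_increasing_numbering[of "{..<dim_row A}"] by blast
  then show thesis using that[of w] by blast
qed

lemma leading_row_greatest:
  assumes "R \<in> row_orders A" "c \<in> nonzero_cols A"
  shows "leading_row R A c \<in> supp A c" "\<And>s. s \<in> supp A c \<Longrightarrow> (s, leading_row R A c) \<in> R"
proof -
  obtain w :: "nat \<Rightarrow> nat" where w: "\<And>r s. (r, s) \<in> R \<Longrightarrow> r \<noteq> s \<Longrightarrow> w r < w s"
    using row_order_imp_numbering[OF assms(1)] by blast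
  have ne: "supp A c \<noteq> {}" using assms(2) by (simp add: nonzero_cols_iff)
  obtain r where r: "r \<in> supp A c" "\<And>s. s \<in> supp A c \<Longrightarrow> w s \<le> w r"
    using finite_supp ne obtains_MAX by (metis (no_types, lifting) Max_ge finite_imageI image_eqI)
  have "(s, r) \<in> R" if s: "s \<in> supp A c" for s
  proof (cases "s = r")
    case True
    then show ?thesis using assms(1) s
      by (auto simp: row_orders_def order_on_defs refl_on_def supp_def)
  next
    case False
    then have "(s, r) \<in> R \<or> (r, s) \<in> R" using assms(1) s r(1)
      by (auto simp: row_orders_def order_on_defs total_on_def supp_def)
    then show ?thesis using w[of r s] r(2)[OF s] False by auto
  qed
  then have "leading_row R A c = r \<and> (\<forall>s \<in> supp A c. (s, r) \<in> R)"
    using leading_row_eqI[OF assms(1) r(1)] by blast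
  then show "leading_row R A c \<in> supp A c" "\<And>s. s \<in> supp A c \<Longrightarrow> (s, leading_row R A c) \<in> R"
    using r(1) by auto
qed

text \<open>
  Several columns may share a leading row; keeping one column for each leading row makes the pivots
  distinct without losing any of them.
\<close>

lemma acyclic_pivots_from_order:
  assumes R: "R \<in> row_orders A"
  obtains C where "acyclic_pivots A C (leading_row R A)" "card C = num_leading_rows R A"
proof -
  obtain C where C: "C \<subseteq> nonzero_cols A" "inj_on (leading_row R A) C"
      "leading_row R A ` C = leading_row R A ` nonzero_cols A"
    using subset_image_inj[of "leading_row R A ` nonzero_cols A" "leading_row R A" "nonzero_cols A"]
    by auto
  obtain w :: "nat \<Rightarrow> nat" where "inj_on w {..<dim_row A}"
    "\<And>r s. (r, s) \<in> R \<Longrightarrow> r \<noteq> s \<Longrightarrow> w r < w s"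
    using row_order_imp_numbering[OF R] by blast
  then have "acyclic_pivots A C (leading_row R A)"
    unfolding acyclic_pivots_iff_numbering using C leading_row_greatest[OF R] 
    by (intro conjI exI[of _ w]) blast+
  moreover have "card C = num_leading_rows R A"
    using C(2,3) by (metis card_image num_leading_rows_def)
  ultimately show thesis using that by blast
qed

lemma finite_nonzero_cols: "finite (nonzero_cols A)"
  by (simp add: nonzero_cols_def)

text \<open>
  Only an inequality can be expected here: columns that were not chosen may contribute
  further leading rows.
\<close>

lemma order_from_acyclic_pivots:
  assumes "acyclic_pivots A C p"
  obtains R where "R \<in> row_orders A" "card C \<le> num_leading_rows R A"
proof -
  from assms obtain w :: "nat \<Rightarrow> nat" where C: "C \<subseteq> nonzero_cols A" "\<forall>c\<in>C. p c \<in> supp A c"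
      "inj_on p C" and w: "inj_on w {..<dim_row A}" "\<forall>c\<in>C. \<forall>r\<in>supp A c - {p c}. w r < w (p c)"
    unfolding acyclic_pivots_iff_numbering by blast
  define R where "R = {(r, s). r < dim_row A \<and> s < dim_row A \<and> w r \<le> w s}"
  have R: "R \<in> row_orders A" unfolding R_def using w(1) by (rule row_order_of_numbering)
  have "leading_row R A c = p c" if c: "c \<in> C" for c
  proof (rule leading_row_eqI[OF R])
    show "p c \<in> supp A c" using C c by blast
    show "(s, p c) \<in> R" if "s \<in> supp A c" for s
      using that w(2) c C(2) by (cases "s = p c") (auto simp: R_def supp_def intro: less_imp_le)
  qed
  then have "p ` C \<subseteq> leading_row R A ` nonzero_cols A" using C(1) by force
  then have "card (p ` C) \<le> num_leading_rows R A"
    unfolding num_leading_rows_def by (intro card_mono finite_imageI finite_nonzero_cols)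
  then show thesis using that[OF R] card_image[OF C(3)] by simp
qed

lemma acyclic_pivots_empty: "acyclic_pivots A {} p"
  by (simp add: acyclic_pivots_def pivot_arrows_def acyclic_def)

lemma finite_pivot_sizes: "finite {card C | C. \<exists>p. acyclic_pivots A C p}"
proof (rule finite_subset)
  show "{card C | C. \<exists>p. acyclic_pivots A C p} \<subseteq> card ` Pow (nonzero_cols A)"
    by (auto simp: acyclic_pivots_def)
qed (simp add: finite_nonzero_cols)

lemma tau_attained:
  obtains C p where "acyclic_pivots A C p" "card C = tau A"
proof -
  have "{card C | C. \<exists>p. acyclic_pivots A C p} \<noteq> {}"
    using acyclic_pivots_empty by blast
  then have "tau A \<in> {card C | C. \<exists>p. acyclic_pivots A C p}"
    unfolding tau_def by (rule Max_in[OF finite_pivot_sizes])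
  then show thesis using that by auto
qed

lemma card_acyclic_pivots_le_tau: "acyclic_pivots A C p \<Longrightarrow> card C \<le> tau A"
  unfolding tau_def by (intro Max_ge finite_pivot_sizes) blast

lemma tau_eq_Max_num_leading_rows: "tau A = Max ((\<lambda>R. num_leading_rows R A) ` row_orders A)"
proof -
  have le: "num_leading_rows R A \<le> tau A" if "R \<in> row_orders A" for R
    using acyclic_pivots_from_order[OF that] card_acyclic_pivots_le_tau by metis
  obtain C p where "acyclic_pivots A C p" "card C = tau A" by (rule tau_attained)
  then obtain R where R: "R \<in> row_orders A" "tau A \<le> num_leading_rows R A"
    using order_from_acyclic_pivots by metis
  then have "num_leading_rows R A = tau A" using le by (simp add: antisym)
  then have attained: "tau A \<in> (\<lambda>R. num_leading_rows R A) ` row_orders A" using R(1) by force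
  have "finite ((\<lambda>R. num_leading_rows R A) ` row_orders A)"
    by (rule finite_subset[of _ "{..tau A}"]) (use le in auto)
  then have "Max ((\<lambda>R. num_leading_rows R A) ` row_orders A) = tau A"
    by (rule Max_eqI) (use attained le in auto)
  then show ?thesis by simp
qed

section \<open>Uniquely restricted matchings\<close>

definition pivot_matching :: "nat set \<Rightarrow> (nat \<Rightarrow> nat) \<Rightarrow> (nat + nat) set set" where
  "pivot_matching C p = (\<lambda>c. {Inl (p c), Inr c}) ` C"

lemma Union_pivot_matching: "\<Union> (pivot_matching C p) = Inl ` p ` C \<union> Inr ` C"
  by (auto simp: pivot_matching_def)

lemma card_pivot_matching: "card (pivot_matching C p) = card C"
  unfolding pivot_matching_def by (intro card_image inj_onI) (auto simp: doubleton_eq_iff)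

lemma pivot_matching_eq_iff: "pivot_matching C p = pivot_matching C q \<longleftrightarrow> (\<forall>c\<in>C. p c = q c)"
  (is "?lhs \<longleftrightarrow> ?rhs")
proof
  assume ?lhs
  show ?rhs
  proof
    fix c assume "c \<in> C"
    then have "{Inl (p c), Inr c} \<in> pivot_matching C q"
      using \<open>?lhs\<close> by (auto simp: pivot_matching_def)
    then show "p c = q c" by (auto simp: pivot_matching_def doubleton_eq_iff)
  qed
qed (simp add: pivot_matching_def)

lemma matching_support_graph_iff:
  "matching (support_graph A) M \<longleftrightarrow>
     (\<exists>C p. C \<subseteq> {..<dim_col A} \<and> (\<forall>c\<in>C. p c \<in> supp A c) \<and> inj_on p C \<and>
        M = pivot_matching C p)"
  (is "?lhs \<longleftrightarrow> ?rhs")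
proof
  assume M: ?lhs
  define C where "C = {c. Inr c \<in> \<Union> M}"
  have edge: "\<exists>r c. e = {Inl r, Inr c} \<and> c < dim_col A \<and> r \<in> supp A c" if "e \<in> M" for e
  proof -
    have "e \<in> snd (support_graph A)" using that M by (auto simp: matching_def)
    then show ?thesis by (auto simp: support_graph_def supp_def)
  qed
  have disj: "e = e'" if "e \<in> M" "e' \<in> M" "x \<in> e" "x \<in> e'" for e e' x
    using M that by (auto simp: matching_def disjoint_def)
  have "\<exists>r. {Inl r, Inr c} \<in> M" if "c \<in> C" for c
    using that edge unfolding C_def by fastforce
  then obtain p where p: "\<And>c. c \<in> C \<Longrightarrow> {Inl (p c), Inr c} \<in> M" by metis
  have "C \<subseteq> {..<dim_col A}" using edge by (fastforce simp: C_def)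
  moreover have "p c \<in> supp A c" if "c \<in> C" for c
    using edge[OF p[OF that]] by (auto simp: doubleton_eq_iff)
  moreover have "inj_on p C"
  proof (rule inj_onI)
    fix c d assume "c \<in> C" "d \<in> C" "p c = p d"
    then have "{Inl (p c), Inr c} = {Inl (p d), Inr d :: nat + nat}"
      using disj[OF p p, of c d "Inl (p c)"] by simp
    then show "c = d" by (auto simp: doubleton_eq_iff)
  qed
  moreover have "M = pivot_matching C p"
  proof
    show "pivot_matching C p \<subseteq> M" using p by (auto simp: pivot_matching_def)
    show "M \<subseteq> pivot_matching C p"
    proof
      fix e assume e: "e \<in> M"
      then obtain r c where rc: "e = {Inl r, Inr c}" using edge by blast
      then have c: "c \<in> C" using e by (auto simp: C_def)
      then have "e = {Inl (p c), Inr c}" using disj[OF e p[OF c], of "Inr c"] rc by simp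
      then show "e \<in> pivot_matching C p" using c by (simp add: pivot_matching_def)
    qed
  qed
  ultimately show ?rhs by blast
next
  assume ?rhs
  then obtain C p where C: "C \<subseteq> {..<dim_col A}" "\<forall>c\<in>C. p c \<in> supp A c" "inj_on p C"
    and M: "M = pivot_matching C p" by blast
  have "M \<subseteq> snd (support_graph A)"
    using C(1,2) by (auto simp: M pivot_matching_def support_graph_def supp_def)
  moreover have "disjoint M"
    using C(3) by (auto simp: M pivot_matching_def disjoint_def dest: inj_onD)
  ultimately show ?lhs by (simp add: matching_def)
qed

lemma perfect_matching_induced_iff:
  assumes "matching G M"
    and "\<forall>e\<in>snd G. e \<subseteq> fst G"
  shows "perfect_matching (induced_sgraph G (\<Union> M)) M' \<longleftrightarrow> matching G M' \<and> \<Union> M' = \<Union> M"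
proof -
  have "fst G \<inter> \<Union> M = \<Union> M" using assms by (auto simp: matching_def)
  then show ?thesis by (auto simp: perfect_matching_def matching_def induced_sgraph_def)
qed

text \<open>
  Any perfect matching of the induced subgraph is a matching of the whole graph that covers the same
  vertices, so induced subgraphs can be eliminated from the definition.
\<close>

lemma uniquely_restricted_iff:
  assumes "\<forall>e\<in>snd G. e \<subseteq> fst G"
  shows "uniquely_restricted G M \<longleftrightarrow>
    matching G M \<and> (\<forall>M'. matching G M' \<and> \<Union> M' = \<Union> M \<longrightarrow> M' = M)"
  unfolding uniquely_restricted_def using perfect_matching_induced_iff[OF _ assms] by blast

lemma uniquely_restricted_pivot_matching_iff:
  assumes C: "C \<subseteq> {..<dim_col A}" "\<forall>c\<in>C. p c \<in> supp A c" "inj_on p C"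
  shows "uniquely_restricted (support_graph A) (pivot_matching C p) \<longleftrightarrow>
    (\<forall>q. (\<forall>c\<in>C. q c \<in> supp A c) \<and> bij_betw q C (p ` C) \<longrightarrow> (\<forall>c\<in>C. q c = p c))"
  (is "_ \<longleftrightarrow> ?rhs")
proof -
  have m: "matching (support_graph A) (pivot_matching C p)"
    using C matching_support_graph_iff by blast
  have verts: "\<Union> (pivot_matching D q) = \<Union> (pivot_matching C p) \<longleftrightarrow> D = C \<and> q ` D = p ` C" for D q
  proof -
    have "Inl -` \<Union> (pivot_matching D q) = q ` D" "Inr -` \<Union> (pivot_matching D q) = D" for D q
      by (auto simp: Union_pivot_matching)
    then show ?thesis by (metis Union_pivot_matching)
  qed
  have perfect: "matching (support_graph A) M' \<and> \<Union> M' = \<Union> (pivot_matching C p) \<longleftrightarrow>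
      (\<exists>q. (\<forall>c\<in>C. q c \<in> supp A c) \<and> bij_betw q C (p ` C) \<and> M' = pivot_matching C q)"
    (is "?matching \<longleftrightarrow> ?transversal") for M'
  proof
    assume ?matching
    then obtain D q where D: "\<forall>c\<in>D. q c \<in> supp A c" "inj_on q D" "M' = pivot_matching D q"
      and same: "\<Union> (pivot_matching D q) = \<Union> (pivot_matching C p)"
      unfolding matching_support_graph_iff by auto
    from same have "D = C \<and> q ` D = p ` C" by (rule verts[THEN iffD1])
    then show ?transversal using D by (auto simp: bij_betw_def)
  next
    assume ?transversal
    then obtain q where q: "\<forall>c\<in>C. q c \<in> supp A c" "inj_on q C" "q ` C = p ` C"
      and M': "M' = pivot_matching C q"
      by (auto simp: bij_betw_def)
    have "matching (support_graph A) M'"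
      unfolding matching_support_graph_iff using C(1) q(1,2) M' by blast
    moreover have "\<Union> (pivot_matching C q) = \<Union> (pivot_matching C p)"
      using q(3) by (simp add: Union_pivot_matching)
    ultimately show ?matching by (simp add: M')
  qed
  have ends: "\<forall>e\<in>snd (support_graph A). e \<subseteq> fst (support_graph A)"
    by (auto simp: support_graph_def)
  have "uniquely_restricted (support_graph A) (pivot_matching C p) \<longleftrightarrow>
      (\<forall>q. (\<forall>c\<in>C. q c \<in> supp A c) \<and> bij_betw q C (p ` C) \<longrightarrow> pivot_matching C q = pivot_matching C p)"
    unfolding uniquely_restricted_iff[OF ends] perfect using m by blast
  then show ?thesis by (simp only: pivot_matching_eq_iff)
qed

text \<open>
  Pivots have the largest number in their column, so \<open>w (q d) \<le> w (p d)\<close> for every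
  chosen column \<open>d\<close>; both sides have the same sum, since \<open>p\<close> and \<open>q\<close> run through the same rows.
  Hence no inequality is strict.
\<close>

lemma acyclic_pivots_imp_unique:
  assumes "acyclic_pivots A C p" and q: "\<And>c. c \<in> C \<Longrightarrow> q c \<in> supp A c" "bij_betw q C (p ` C)"
    and "c \<in> C"
  shows "q c = p c"
proof (rule ccontr)
  assume "q c \<noteq> p c"
  from assms(1) obtain w :: "nat \<Rightarrow> nat" where C: "C \<subseteq> nonzero_cols A" "inj_on p C" 
    and w: "\<forall>c\<in>C. \<forall>r\<in>supp A c - {p c}. w r < w (p c)"
    unfolding acyclic_pivots_iff_numbering by blast
  have "finite C" using C(1) finite_nonzero_cols finite_subset by blast
  have "(\<Sum>d\<in>C. w (q d)) < (\<Sum>d\<in>C. w (p d))"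
  proof (rule sum_strict_mono_ex1[OF \<open>finite C\<close>])
    show "\<forall>d\<in>C. w (q d) \<le> w (p d)" using w q(1) by (metis Diff_iff less_imp_le order_refl singletonD)
    show "\<exists>d\<in>C. w (q d) < w (p d)" using w q(1) \<open>c \<in> C\<close> \<open>q c \<noteq> p c\<close> by blast
  qed
  moreover have "(\<Sum>d\<in>C. w (q d)) = (\<Sum>r\<in>p ` C. w r)"
    using q(2) by (rule sum.reindex_bij_betw)
  moreover have "(\<Sum>d\<in>C. w (p d)) = (\<Sum>r\<in>p ` C. w r)"
    using C(2) by (simp add: sum.reindex)
  ultimately show False by simp
qed

text \<open>
  Along a directed cycle, each pivot can be exchanged for the preceding row of the cycle, which lies
  in the support of the same column. The rows used stay the same, so this contradicts
  uniqueness.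
\<close>

lemma unique_imp_acyclic_pivots:
  assumes C: "C \<subseteq> {..<dim_col A}" and p: "\<forall>c\<in>C. p c \<in> supp A c" "inj_on p C"
    and unique: "\<forall>q. (\<forall>c\<in>C. q c \<in> supp A c) \<and> bij_betw q C (p ` C) \<longrightarrow> (\<forall>c\<in>C. q c = p c)"
  shows "acyclic_pivots A C p"
proof -
  have "acyclic (pivot_arrows A C p)"
  proof (rule ccontr)
    assume cyclic: "\<not> acyclic (pivot_arrows A C p)"
    have "pivot_arrows A C p \<subseteq> {..<dim_row A} \<times> {..<dim_row A}"
      using p(1) by (auto simp: pivot_arrows_def supp_def)
    then obtain S g where "S \<subseteq> {..<dim_row A}" and S: "S \<noteq> {}" "bij_betw g S S"
      and g: "\<forall>s\<in>S. (g s, s) \<in> pivot_arrows A C p"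
      by (rule not_acyclic_imp_predecessor_permutation[OF finite_lessThan _ cyclic])
    have "S \<subseteq> p ` C" using g by (auto simp: pivot_arrows_def)
    have g_supp: "g (p c) \<in> supp A c - {p c}" if "c \<in> C" "p c \<in> S" for c
      using bspec[OF g that(2)] that(1) p(2) by (auto simp: pivot_arrows_def dest: inj_onD)
    define h where "h r = (if r \<in> S then g r else r)" for r
    have "bij_betw h S S" using S(2) by (simp add: h_def cong: bij_betw_cong)
    moreover have "bij_betw h (p ` C - S) (p ` C - S)"
      by (auto simp: h_def bij_betw_def inj_on_def)
    ultimately have "bij_betw h (S \<union> (p ` C - S)) (S \<union> (p ` C - S))"
      by (rule bij_betw_combine) auto
    then have "bij_betw h (p ` C) (p ` C)" using \<open>S \<subseteq> p ` C\<close> by (simp add: Un_absorb1)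
    then have "bij_betw (h \<circ> p) C (p ` C)"
      by (rule bij_betw_trans[OF inj_on_imp_bij_betw[OF p(2)]])
    moreover have "\<forall>c\<in>C. (h \<circ> p) c \<in> supp A c"
      using g_supp p(1) by (auto simp: h_def)
    ultimately have fixed: "\<forall>c\<in>C. (h \<circ> p) c = p c" using unique by blast
    obtain c where "c \<in> C" "p c \<in> S" using \<open>S \<subseteq> p ` C\<close> \<open>S \<noteq> {}\<close> by blast
    then show False using fixed g_supp[of c] by (auto simp: h_def)
  qed
  moreover have "C \<subseteq> nonzero_cols A" using C p(1) by (force simp: nonzero_cols_iff)
  ultimately show ?thesis using p by (simp add: acyclic_pivots_def)
qed

lemma uniquely_restricted_iff_acyclic_pivots:
  "uniquely_restricted (support_graph A) M \<longleftrightarrow>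
     (\<exists>C p. acyclic_pivots A C p \<and> M = pivot_matching C p)"
proof
  assume M: "uniquely_restricted (support_graph A) M"
  then obtain C p where C: "C \<subseteq> {..<dim_col A}" "\<forall>c\<in>C. p c \<in> supp A c" "inj_on p C"
    and eq: "M = pivot_matching C p"
    unfolding uniquely_restricted_def matching_support_graph_iff by blast
  have "acyclic_pivots A C p"
    using M unfolding eq uniquely_restricted_pivot_matching_iff[OF C]
    by (rule unique_imp_acyclic_pivots[OF C])
  then show "\<exists>C p. acyclic_pivots A C p \<and> M = pivot_matching C p" using eq by blast
next
  assume "\<exists>C p. acyclic_pivots A C p \<and> M = pivot_matching C p"
  then obtain C p where ac: "acyclic_pivots A C p" and eq: "M = pivot_matching C p" by blast
  have C: "C \<subseteq> {..<dim_col A}" "\<forall>c\<in>C. p c \<in> supp A c" "inj_on p C"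
    using ac by (auto simp: acyclic_pivots_def nonzero_cols_iff)
  show "uniquely_restricted (support_graph A) M"
    unfolding eq uniquely_restricted_pivot_matching_iff[OF C]
    using acyclic_pivots_imp_unique[OF ac] by blast
qed

lemma tau_eq_nu_ur: "tau A = nu_ur (support_graph A)"
proof -
  have "{card C | C. \<exists>p. acyclic_pivots A C p} =
      {card M | M. uniquely_restricted (support_graph A) M}"
    (is "?pivots = ?matchings")
  proof (intro equalityI subsetI)
    fix k assume "k \<in> ?pivots"
    then obtain C p where "acyclic_pivots A C p" "k = card (pivot_matching C p)"
      by (auto simp: card_pivot_matching)
    then show "k \<in> ?matchings" using uniquely_restricted_iff_acyclic_pivots by blast
  next
    fix k assume "k \<in> ?matchings"
    then obtain C p where "acyclic_pivots A C p" "k = card C"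
      by (auto simp: uniquely_restricted_iff_acyclic_pivots card_pivot_matching)
    then show "k \<in> ?pivots" by blast
  qed
  then show ?thesis by (simp add: tau_def nu_ur_def)
qed

section \<open>The rank bound\<close>

text \<open>
  The hypothesis on \<open>w\<close> is triangularity without an explicit ordering of the columns: row \<open>p c\<close>
  vanishes in all other chosen columns that are not heavier than \<open>c\<close>. In a vanishing linear
  combination, let \<open>c\<close> be a heaviest column with nonzero coefficient; then row \<open>p c\<close> sees only
  the term of \<open>c\<close>. Equal columns are also excluded, so that counting labels agrees with
  counting vectors.
\<close>

lemma (in vec_space) triangular_columns_card_le_rank:
  fixes w :: "nat \<Rightarrow> nat"
  assumes A: "A \<in> carrier_mat n nc" and C: "C \<subseteq> {..<nc}"
    and p: "\<And>c. c \<in> C \<Longrightarrow> p c < n" "\<And>c. c \<in> C \<Longrightarrow> A $$ (p c, c) \<noteq> 0"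
    and w: "\<And>c d. c \<in> C \<Longrightarrow> d \<in> C \<Longrightarrow> c \<noteq> d \<Longrightarrow> A $$ (p c, d) \<noteq> 0 \<Longrightarrow> w c < w d"
  shows "card C \<le> rank A"
proof -
  have entry: "col A d $ p c = A $$ (p c, d)" if "c \<in> C" "d \<in> C" for c d
    using that A C p(1) by auto
  have inj: "inj_on (col A) C"
  proof (rule inj_onI, rule ccontr)
    fix c d assume cd: "c \<in> C" "d \<in> C" "col A c = col A d" "c \<noteq> d"
    then have "A $$ (p c, d) \<noteq> 0" "A $$ (p d, c) \<noteq> 0"
      using entry p(2) by metis+
    then show False using w[of c d] w[of d c] cd by simp
  qed
  have carrier: "col A ` C \<subseteq> carrier_vec n" using A by auto
  have "lin_indpt (col A ` C)"
  proof
    assume "lin_dep (col A ` C)"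
    then obtain X a v where X: "finite X" "X \<subseteq> col A ` C" and zero: "lincomb a X = 0\<^sub>v n"
      and v: "v \<in> X" "a v \<noteq> 0"
      unfolding lin_dep_def by auto
    define D where "D = {d \<in> C. col A d \<in> X \<and> a (col A d) \<noteq> 0}"
    have "finite C" using C by (rule finite_subset) simp
    then have "finite D" by (simp add: D_def)
    moreover have "D \<noteq> {}" using v X(2) by (auto simp: D_def)
    ultimately obtain c where c: "c \<in> D" and max: "\<And>d. d \<in> D \<Longrightarrow> w d \<le> w c"
      by (metis (no_types, lifting) Max_ge finite_imageI image_eqI obtains_MAX)
    have cC: "c \<in> C" and cX: "col A c \<in> X" and ac: "a (col A c) \<noteq> 0" using c by (auto simp: D_def)
    have "0 = lincomb a X $ p c" using zero p(1)[OF cC] by simp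
    also have "\<dots> = (\<Sum>x\<in>X. a x * x $ p c)"
      using p(1)[OF cC] X(2) carrier by (intro lincomb_index) auto
    also have "\<dots> = a (col A c) * col A c $ p c"
    proof -
      have "a x * x $ p c = 0" if x: "x \<in> X - {col A c}" for x
      proof (rule ccontr)
        assume nz: "a x * x $ p c \<noteq> 0"
        obtain d where d: "d \<in> C" "x = col A d" using x X(2) by blast
        then have "d \<in> D" "d \<noteq> c" "A $$ (p c, d) \<noteq> 0"
          using nz x entry[OF cC d(1)] by (auto simp: D_def)
        then show False using w[OF cC d(1)] max[of d] by auto
      qed
      then have "(\<Sum>x\<in>X - {col A c}. a x * x $ p c) = 0" by (intro sum.neutral) blast
      then show ?thesis using sum.remove[OF X(1) cX, of "\<lambda>x. a x * x $ p c"] by simp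
    qed
    finally show False using ac p(2)[OF cC] entry[OF cC cC] by simp
  qed
  moreover have "col A ` C \<subseteq> set (cols A)" using A C by (auto simp: cols_def)
  ultimately have "card (col A ` C) \<le> rank A" using rank_ge_card_indpt[OF A] by blast
  then show ?thesis using card_image[OF inj] by simp
qed

lemma acyclic_pivots_card_le_rank:
  assumes "acyclic_pivots A C p"
  shows "card C \<le> vec_space.rank (dim_row A) A"
proof -
  from assms obtain w :: "nat \<Rightarrow> nat" where C: "C \<subseteq> nonzero_cols A" "\<forall>c\<in>C. p c \<in> supp A c"
      "inj_on p C" and w: "\<forall>c\<in>C. \<forall>r\<in>supp A c - {p c}. w r < w (p c)"
    unfolding acyclic_pivots_iff_numbering by blast
  show ?thesis
  proof (rule vec_space.triangular_columns_card_le_rank[where w = "\<lambda>c. w (p c)" and p = p])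
    show "A \<in> carrier_mat (dim_row A) (dim_col A)" by simp
    show "C \<subseteq> {..<dim_col A}" using C(1) by (auto simp: nonzero_cols_def)
    show "p c < dim_row A" "A $$ (p c, c) \<noteq> 0" if "c \<in> C" for c
      using C(2) that by (auto simp: supp_def)
    show "w (p c) < w (p d)" if "c \<in> C" "d \<in> C" "c \<noteq> d" "A $$ (p c, d) \<noteq> 0" for c d
    proof -
      have "p c \<in> supp A d" using that C(2) by (auto simp: supp_def)
      moreover have "p c \<noteq> p d" using that C(3) by (auto dest: inj_onD)
      ultimately show ?thesis using w that by blast
    qed
  qed
qed

lemma tau_le_rank: "tau A \<le> vec_space.rank (dim_row A) A"
  using tau_attained acyclic_pivots_card_le_rank by metis

theorem theorem4p4:
  fixes A :: "bit mat"
  shows "tau A = Max ((\<lambda>R. num_leading_rows R A) ` row_orders A) \<and>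
         Max ((\<lambda>R. num_leading_rows R A) ` row_orders A) = nu_ur (support_graph A) \<and>
         nu_ur (support_graph A) \<le> vec_space.rank (dim_row A) A"
  using tau_eq_Max_num_leading_rows[of A] tau_eq_nu_ur[of A] tau_le_rank[of A] by simp

end
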